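(* Let $n\ge 1$, let $x_1\neq x_2$ be two vectors in $\mathbb{R}^n$, let $\alpha,\beta>0$, and let $Q_1,Q_2\in\mathbb{R}^{n\times n}$ be two symmetric positive definite matrices. Consider the bi-objective minimization problem $(f_1,f_2)$ on $\mathbb{R}^n$ with $$f_1(x)=\frac1\alpha (x-x_1)^\top Q_1(x-x_1),\qquad f_2(x)=\frac1\beta (x-x_2)^\top Q_2(x-x_2).$$ Then the Pareto front of $(f_1,f_2)$ is a convex curve, with vertical tangent at $(0,f_2(x_1))$ and horizontal tangent at $(f_1(x_2),0)$.
   Context: The Pareto set of a bi-objective minimization problem $(f_1,f_2)$ on $\mathbb{R}^n$ is the set of all $x\in\mathbb{R}^n$ for which there is no $y\in\mathbb{R}^n$ with $f_1(y)\le f_1(x)$ and $f_2(y)\le f_2(x)$ and at least one of these inequalities strict. The Pareto front is the image of the Pareto set in the objective space $\mathbb{R}^2$ under $x\mapsto (f_1(x),f_2(x))$. The Pareto front is viewed as the graph of a one-variable function $g$, expressing the second objective value as a function of the first ($f_2(x)=g(f_1(x))$ for $x$ in the Pareto set); it is a convex curve if $g$ is convex. A vertical tangent is a tangent line parallel to the axis of the second objective, a horizontal tangent one parallel to the axis of the first objective. *)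

theory Defs
  imports "HOL-Analysis.Analysis"
begin

definition symmetric_matrix :: "real^'n^'n \<Rightarrow> bool" where
  "symmetric_matrix A \<longleftrightarrow> transpose A = A"

definition positive_definite :: "real^'n^'n \<Rightarrow> bool" where
  "positive_definite A \<longleftrightarrow> (\<forall>x. x \<noteq> 0 \<longrightarrow> x \<bullet> (A *v x) > 0)"

definition pareto_set :: "('a \<Rightarrow> real) \<Rightarrow> ('a \<Rightarrow> real) \<Rightarrow> 'a set" where
  "pareto_set f1 f2 =
     {x. \<not> (\<exists>y. f1 y \<le> f1 x \<and> f2 y \<le> f2 x \<and> (f1 y < f1 x \<or> f2 y < f2 x))}"

definition pareto_front :: "('a \<Rightarrow> real) \<Rightarrow> ('a \<Rightarrow> real) \<Rightarrow> (real \<times> real) set" where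
  "pareto_front f1 f2 = (\<lambda>x. (f1 x, f2 x)) ` pareto_set f1 f2"

(* C is the graph of a convex function g with domain fst ` C. Convexity of the domain,
   i.e. that fst ` C is an interval, is part of convex_on. *)
definition convex_curve :: "(real \<times> real) set \<Rightarrow> bool" where
  "convex_curve C \<longleftrightarrow>
     (\<exists>g. (\<forall>p\<in>C. snd p = g (fst p)) \<and> convex_on (fst ` C) g)"

(* The line L through p is tangent to C at p if the secants of C through p converge to L:
   infdist q L / dist q p is the sine of the angle between L and the secant through p and q.
   The limit is taken along C, so at an endpoint of a curve it is one-sided;
   the limit point condition keeps it from being vacuous. *)
definition tangent_line :: "'a::real_normed_vector set \<Rightarrow> 'a \<Rightarrow> 'a set \<Rightarrow> bool" where
  "tangent_line C p L \<longleftrightarrow>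
     p \<in> C \<and> p islimpt C \<and> (\<exists>v. v \<noteq> 0 \<and> L = range (\<lambda>t::real. p + t *\<^sub>R v)) \<and>
     ((\<lambda>q. infdist q L / dist q p) \<longlongrightarrow> 0) (at p within C)"

definition vertical_tangent :: "(real \<times> real) set \<Rightarrow> real \<times> real \<Rightarrow> bool" where
  "vertical_tangent C p \<longleftrightarrow> (\<exists>L. tangent_line C p L \<and> affine_parallel ({0} \<times> UNIV) L)"

definition horizontal_tangent :: "(real \<times> real) set \<Rightarrow> real \<times> real \<Rightarrow> bool" where
  "horizontal_tangent C p \<longleftrightarrow> (\<exists>L. tangent_line C p L \<and> affine_parallel (UNIV \<times> {0}) L)"

end

(* Minimizing f2 over the compact sublevel sets of f1 gives exactly one Pareto point at every level
   of f1 between f1 x1 and f1 x2, and mixing two Pareto points shows that the minimum is a convex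
   function of the level. With M = f1 x2 and N = f2 x1, the segment from x1 to x2 is mapped
   to the arc (s^2 M, (1 - s)^2 N), which touches both axes tangentially. The front lies between
   this arc and the axes, so near (0, N) it satisfies u <= (M / N^2) (N - v)^2, and symmetrically
   near (M, 0). *)
theory Submission
  imports Defs
begin

section \<open>Pareto sets of strictly convex functions\<close>

lemma pareto_set_commute: "pareto_set f g = pareto_set g f"
  unfolding pareto_set_def by blast

lemma pareto_setD:
  assumes "x \<in> pareto_set f g" and "f y \<le> f x"
  shows "g x \<le> g y"
proof (rule ccontr)
  assume "\<not> g x \<le> g y"
  then have "g y \<le> g x" "g y < g x" by simp_all
  with assms show False unfolding pareto_set_def by blast
qed

definition strictly_convex :: "('a::real_vector \<Rightarrow> real) \<Rightarrow> bool" where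
  "strictly_convex f \<longleftrightarrow>
     (\<forall>x y t. x \<noteq> y \<longrightarrow> 0 < t \<longrightarrow> t < 1 \<longrightarrow> f ((1 - t) *\<^sub>R x + t *\<^sub>R y) < (1 - t) * f x + t * f y)"

lemma strictly_convexD:
  assumes "strictly_convex f" "x \<noteq> y" "0 < t" "t < 1"
  shows "f ((1 - t) *\<^sub>R x + t *\<^sub>R y) < (1 - t) * f x + t * f y"
  using assms unfolding strictly_convex_def by blast

lemma strictly_convex_le:
  assumes "strictly_convex f" "0 < t" "t < 1"
  shows "f ((1 - t) *\<^sub>R x + t *\<^sub>R y) \<le> (1 - t) * f x + t * f y"
proof (cases "x = y")
  case True
  then show ?thesis by (simp flip: scaleR_left_distrib) (simp add: algebra_simps)
next
  case False
  then show ?thesis using strictly_convexD[OF assms(1) _ assms(2,3)] by (meson less_imp_le)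
qed

text \<open>The point is a minimizer \<open>y\<close> of \<open>g\<close> on the sublevel set
  \<open>f \<le> u\<close>. Anything dominating \<open>y\<close> would, mixed with \<open>y\<close>,
  give a smaller value of \<open>g\<close> inside this set; if the level were not reached, a small
  move towards \<open>b\<close> would do the same.\<close>

lemma ex_pareto_at_level:
  fixes f g :: "'a::real_normed_vector \<Rightarrow> real"
  assumes f: "strictly_convex f" and g: "strictly_convex g"
    and cont: "continuous_on UNIV g" and compact: "compact {x. f x \<le> u}"
    and b: "\<And>x. g b \<le> g x" and u: "f a \<le> u" "u \<le> f b"
  obtains x where "x \<in> pareto_set f g" "f x = u"
proof -
  have "{x. f x \<le> u} \<noteq> {}" using u by blast
  then obtain y where y: "f y \<le> u" and min: "\<And>z. f z \<le> u \<Longrightarrow> g y \<le> g z"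
    using continuous_attains_inf[OF compact _ continuous_on_subset[OF cont subset_UNIV]] by auto
  have "y \<in> pareto_set f g"
  proof (rule ccontr)
    assume "y \<notin> pareto_set f g"
    then obtain z where z: "f z \<le> f y" "g z \<le> g y" "f z < f y \<or> g z < g y"
      unfolding pareto_set_def by blast
    \<comment> \<open>The midpoint covers both cases of domination: even if only
      \<open>f z < f y\<close> is strict, \<open>y \<noteq> z\<close> and strict convexity lower
      \<open>g\<close> strictly.\<close>
    let ?m = "(1 - 1/2) *\<^sub>R y + (1/2) *\<^sub>R z"
    have "y \<noteq> z" using z(3) by auto
    from strictly_convexD[OF g this, of "1/2"] have "g ?m < g y" using z(2) by simp
    moreover have "f ?m \<le> u"
      using strictly_convex_le[OF f, of "1/2" y z] z(1) y by simp
    ultimately show False using min[of ?m] by simp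
  qed
  moreover have "f y = u"
  proof (rule ccontr)
    assume "f y \<noteq> u"
    with y have lt: "f y < u" by simp
    with u have lt': "f y < f b" by simp
    \<comment> \<open>At the full quotient the convexity bound on \<open>f\<close> along the segment
      from \<open>y\<close> to \<open>b\<close> reaches \<open>u\<close>. Half of it keeps
      \<open>t < 1\<close> even for \<open>u = f b\<close>.\<close>
    define t where "t = (u - f y) / (f b - f y) / 2"
    have t: "0 < t" "t < 1" using lt lt' u by (auto simp: t_def divide_less_eq)
    have t': "t * (f b - f y) \<le> u - f y" using lt lt' by (simp add: t_def divide_le_eq)
    let ?z = "(1 - t) *\<^sub>R y + t *\<^sub>R b"
    have "y \<noteq> b" using lt' by auto
    from strictly_convexD[OF g this t(1,2)] have "g ?z < (1 - t) * g y + t * g b" .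
    also have "\<dots> \<le> g y" using b[of y] t by (simp add: algebra_simps mult_left_mono)
    finally have "g ?z < g y" .
    moreover have "f ?z \<le> u"
      using strictly_convex_le[OF f t(1,2), of y b] t' by (simp add: algebra_simps)
    ultimately show False using min[of ?z] by simp
  qed
  ultimately show ?thesis using that by blast
qed

text \<open>At a mixed level a Pareto point \<open>w\<close> exists by convexity of the image. The
  same mixture of two Pareto points has \<open>f\<close> at most that level, so \<open>w\<close> is
  at least as good for \<open>g\<close>.\<close>

lemma convex_curve_pareto_front:
  fixes f g :: "'a::real_vector \<Rightarrow> real"
  assumes f: "strictly_convex f" and g: "strictly_convex g"
    and conv: "convex (f ` pareto_set f g)"
  shows "convex_curve (pareto_front f g)"
proof -
  let ?P = "pareto_set f g"
  define h where "h u = g (inv_into ?P f u)" for u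
  \<comment> \<open>Pareto points with equal \<open>f\<close> have equal \<open>g\<close>, so the
    choice made by \<open>inv_into\<close> is immaterial.\<close>
  have h: "h (f p) = g p" if "p \<in> ?P" for p
  proof -
    let ?q = "inv_into ?P f (f p)"
    have "?q \<in> ?P" "f ?q = f p" using that by (auto intro: inv_into_into f_inv_into_f)
    then show ?thesis
      unfolding h_def using pareto_setD[of _ f g] that by (metis order.antisym order.refl)
  qed
  have fst_front: "fst ` pareto_front f g = f ` ?P"
    by (auto simp: pareto_front_def image_image)
  have "convex_on (f ` ?P) h"
  proof (rule convex_onI[OF _ conv])
    fix t u v :: real
    assume t: "0 < t" "t < 1" and "u \<in> f ` ?P" "v \<in> f ` ?P"
    then obtain p q where p: "p \<in> ?P" "u = f p" and q: "q \<in> ?P" "v = f q" by blast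
    have "(1 - t) *\<^sub>R u + t *\<^sub>R v \<in> f ` ?P"
      using conv p q t by (intro convexD) auto
    then obtain w where w: "w \<in> ?P" "f w = (1 - t) *\<^sub>R u + t *\<^sub>R v" by (metis imageE)
    let ?z = "(1 - t) *\<^sub>R p + t *\<^sub>R q"
    have "f ?z \<le> f w" using strictly_convex_le[OF f t, of p q] w p q by simp
    then have "g w \<le> g ?z" using pareto_setD[OF w(1)] by blast
    also have "\<dots> \<le> (1 - t) * g p + t * g q" by (rule strictly_convex_le[OF g t])
    finally show "h ((1 - t) *\<^sub>R u + t *\<^sub>R v) \<le> (1 - t) * h u + t * h v"
      using h w p q by metis
  qed
  then show ?thesis
    unfolding convex_curve_def fst_front by (intro exI[of _ h]) (auto simp: pareto_front_def h)
qed

section \<open>Tangent lines by second-order contact\<close>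

text \<open>Quadratic contact bounds the sine of the angle between secant and line by
  \<open>K * dist q p\<close>, which tends to 0.\<close>

lemma tangent_lineI:
  fixes C :: "'a::real_normed_vector set"
  assumes "p \<in> C" "p islimpt C" "v \<noteq> 0" and L: "L = range (\<lambda>t::real. p + t *\<^sub>R v)"
    and contact: "\<And>q. q \<in> C \<Longrightarrow> infdist q L \<le> K * (dist q p)\<^sup>2"
  shows "tangent_line C p L"
proof -
  have "((\<lambda>q. dist q p) \<longlongrightarrow> 0) (at p within C)"
    using tendsto_dist[OF tendsto_ident_at tendsto_const, of p p C] by simp
  then have lim: "((\<lambda>q. K * dist q p) \<longlongrightarrow> 0) (at p within C)"
    by (rule tendsto_mult_right_zero)
  have "infdist q L / dist q p \<le> K * dist q p" if "q \<in> C" "q \<noteq> p" for q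
    using contact[OF that(1)] that(2) by (simp add: divide_le_eq power2_eq_square mult.assoc)
  then have "\<forall>\<^sub>F q in at p within C. infdist q L / dist q p \<le> K * dist q p"
    by (auto simp: eventually_at_filter)
  moreover have "\<forall>\<^sub>F q in at p within C. 0 \<le> infdist q L / dist q p"
    by (simp add: infdist_nonneg)
  ultimately have "((\<lambda>q. infdist q L / dist q p) \<longlongrightarrow> 0) (at p within C)"
    by (intro tendsto_sandwich[OF _ _ tendsto_const lim])
  with assms show ?thesis unfolding tangent_line_def by blast
qed

text \<open>The point of the vertical line at the height of \<open>q\<close> differs from
  \<open>q\<close> only in the first coordinate, so that difference bounds the distance to the
  line.\<close>

lemma vertical_tangentI:
  assumes "p \<in> C" "p islimpt C"
    and contact: "\<And>q. q \<in> C \<Longrightarrow> \<bar>fst q - fst p\<bar> \<le> K * (snd q - snd p)\<^sup>2" and K: "0 \<le> K"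
  shows "vertical_tangent C p"
proof -
  let ?L = "range (\<lambda>t::real. p + t *\<^sub>R (0, 1))"
  have "infdist q ?L \<le> K * (dist q p)\<^sup>2" if "q \<in> C" for q
  proof -
    have "infdist q ?L \<le> dist q (p + (snd q - snd p) *\<^sub>R (0, 1))" by (rule infdist_le) blast
    also have "\<dots> = \<bar>fst q - fst p\<bar>" by (simp add: dist_prod_def dist_real_def)
    also have "\<dots> \<le> K * (snd q - snd p)\<^sup>2" by (rule contact[OF that])
    also have "\<dots> \<le> K * (dist q p)\<^sup>2"
      using K by (intro mult_left_mono) (auto simp: dist_prod_def dist_real_def)
    finally show ?thesis .
  qed
  then have "tangent_line C p ?L"
    using assms by (intro tangent_lineI[where v = "(0, 1)"]) (auto simp: zero_prod_def)
  moreover have "affine_parallel ({0} \<times> UNIV) ?L"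
    unfolding affine_parallel_def by (rule exI[of _ p]) (auto simp: image_iff prod_eq_iff)
  ultimately show ?thesis unfolding vertical_tangent_def by blast
qed

lemma horizontal_tangentI:
  assumes "p \<in> C" "p islimpt C"
    and contact: "\<And>q. q \<in> C \<Longrightarrow> \<bar>snd q - snd p\<bar> \<le> K * (fst q - fst p)\<^sup>2" and K: "0 \<le> K"
  shows "horizontal_tangent C p"
proof -
  let ?L = "range (\<lambda>t::real. p + t *\<^sub>R (1, 0))"
  have "infdist q ?L \<le> K * (dist q p)\<^sup>2" if "q \<in> C" for q
  proof -
    have "infdist q ?L \<le> dist q (p + (fst q - fst p) *\<^sub>R (1, 0))" by (rule infdist_le) blast
    also have "\<dots> = \<bar>snd q - snd p\<bar>" by (simp add: dist_prod_def dist_real_def)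
    also have "\<dots> \<le> K * (fst q - fst p)\<^sup>2" by (rule contact[OF that])
    also have "\<dots> \<le> K * (dist q p)\<^sup>2"
      using K by (intro mult_left_mono) (auto simp: dist_prod_def dist_real_def)
    finally show ?thesis .
  qed
  then have "tangent_line C p ?L"
    using assms by (intro tangent_lineI[where v = "(1, 0)"]) (auto simp: zero_prod_def)
  moreover have "affine_parallel (UNIV \<times> {0}) ?L"
    unfolding affine_parallel_def by (rule exI[of _ p]) (auto simp: image_iff prod_eq_iff)
  ultimately show ?thesis unfolding horizontal_tangent_def by blast
qed

section \<open>Positive definite quadratic functions\<close>

text \<open>The constant is the minimum of the form on the unit sphere; homogeneity of degree 2
  carries the bound to all vectors.\<close>

lemma positive_definite_coercive:
  assumes "positive_definite (Q :: real^'n^'n)"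
  obtains c where "0 < c" "\<And>x. c * (norm x)\<^sup>2 \<le> x \<bullet> (Q *v x)"
proof -
  let ?S = "sphere (0 :: real^'n) 1"
  have "continuous_on ?S (\<lambda>x. x \<bullet> (Q *v x))" by (intro continuous_intros)
  moreover have "?S \<noteq> {}" by simp
  ultimately obtain e where e: "e \<in> ?S" "\<And>x. x \<in> ?S \<Longrightarrow> e \<bullet> (Q *v e) \<le> x \<bullet> (Q *v x)"
    using continuous_attains_inf[OF compact_sphere, of 0 1 "\<lambda>x. x \<bullet> (Q *v x)"] by blast
  show thesis
  proof
    show "0 < e \<bullet> (Q *v e)" using assms e(1) unfolding positive_definite_def by (cases "e = 0") auto
    show "e \<bullet> (Q *v e) * (norm x)\<^sup>2 \<le> x \<bullet> (Q *v x)" for x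
    proof (cases "x = 0")
      case False
      have "e \<bullet> (Q *v e) \<le> sgn x \<bullet> (Q *v sgn x)"
        using False by (intro e(2)) (simp add: norm_sgn)
      also have "\<dots> = x \<bullet> (Q *v x) / (norm x)\<^sup>2"
        by (simp add: sgn_div_norm matrix_vector_mult_scaleR power2_eq_square field_simps)
      finally show ?thesis using False by (simp add: field_simps)
    qed simp
  qed
qed

text \<open>Here \<open>k\<close> stands for \<open>1 / \<alpha>\<close> or
  \<open>1 / \<beta>\<close>. The objective is a parameter tied to its formula by an assumption, so
  that \<open>f1\<close> and \<open>f2\<close> can be inserted directly.\<close>

locale pd_quadratic =
  fixes Q :: "real^'n^'n" and a :: "real^'n" and k :: real and f :: "real^'n \<Rightarrow> real"
  assumes pd: "positive_definite Q" and k: "0 < k"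
    and f: "f x = k * ((x - a) \<bullet> (Q *v (x - a)))"
begin

lemma center [simp]: "f a = 0"
  by (simp add: f)

lemma pos: "x \<noteq> a \<Longrightarrow> 0 < f x"
  using pd k by (simp add: f positive_definite_def)

lemma nonneg: "0 \<le> f x"
  using pos[of x] by (cases "x = a") auto

lemma continuous: "continuous_on UNIV f"
  unfolding f by (intro continuous_intros linear_continuous_on_compose[OF _ matrix_vector_mul_linear])

lemma on_ray: "f (a + s *\<^sub>R (x - a)) = s\<^sup>2 * f x"
  by (simp add: f matrix_vector_mult_scaleR power2_eq_square)

lemma strictly_convex: "strictly_convex f"
  unfolding strictly_convex_def
proof (intro allI impI)
  fix x y :: "real^'n" and t :: real
  assume xy: "x \<noteq> y" and t: "0 < t" "t < 1"
  define d e where "d = x - a" and "e = y - a"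
  have "(1 - t) *\<^sub>R x + t *\<^sub>R y - a = (1 - t) *\<^sub>R d + t *\<^sub>R e"
    by (simp add: d_def e_def algebra_simps)
  \<comment> \<open>The gap in the convexity inequality is computed exactly: it is a positive
    multiple of the form at \<open>x - y\<close>.\<close>
  then have "f ((1 - t) *\<^sub>R x + t *\<^sub>R y)
      = (1 - t) * f x + t * f y - k * (t * (1 - t) * ((d - e) \<bullet> (Q *v (d - e))))"
    unfolding f d_def[symmetric] e_def[symmetric]
    by (simp add: matrix_vector_right_distrib matrix_vector_mult_diff_distrib
        matrix_vector_mult_scaleR inner_simps) (simp add: field_simps)
  moreover have "0 < k * (t * (1 - t) * ((d - e) \<bullet> (Q *v (d - e))))"
    using xy t k pd by (simp add: positive_definite_def d_def e_def)
  ultimately show "f ((1 - t) *\<^sub>R x + t *\<^sub>R y) < (1 - t) * f x + t * f y" by simp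
qed

lemma compact_sublevel: "compact {x. f x \<le> u}"
proof -
  obtain c where c: "0 < c" "\<And>x. c * (norm x)\<^sup>2 \<le> x \<bullet> (Q *v x)"
    using positive_definite_coercive[OF pd] by blast
  have "{x. f x \<le> u} \<subseteq> cball a (sqrt (u / (k * c)))"
  proof safe
    fix x assume "f x \<le> u"
    then have "k * (c * (norm (x - a))\<^sup>2) \<le> u"
      using mult_left_mono[OF c(2)[of "x - a"], of k] k unfolding f by linarith
    then have "(norm (x - a))\<^sup>2 \<le> u / (k * c)" using k c by (simp add: field_simps)
    then show "x \<in> cball a (sqrt (u / (k * c)))"
      by (simp add: dist_norm norm_minus_commute real_le_rsqrt)
  qed
  then have "bounded {x. f x \<le> u}" using bounded_cball bounded_subset by blast
  moreover have "closed {x. f x \<le> u}"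
    using continuous by (intro closed_Collect_le) auto
  ultimately show ?thesis by (simp add: compact_eq_bounded_closed)
qed

end

section \<open>Two quadratics with distinct centers\<close>

locale pd_quadratic_pair =
  f: pd_quadratic Q1 x1 k1 f + g: pd_quadratic Q2 x2 k2 g
  for Q1 x1 k1 f Q2 x2 k2 g +
  assumes neq: "x1 \<noteq> x2"
begin

text \<open>Everything shown for the end of the front at \<open>x1\<close> thereby holds for the end
  at \<open>x2\<close>.\<close>

lemma swap: "pd_quadratic_pair Q2 x2 k2 g Q1 x1 k1 f"
  using neq by unfold_locales auto

lemma pos: "0 < f x2" "0 < g x1"
  using neq by (auto intro: f.pos g.pos)

text \<open>As \<open>g\<close> vanishes at \<open>x2\<close>, a point with a larger value of
  \<open>f\<close> would be dominated by \<open>x2\<close>.\<close>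

lemma pareto_le: "p \<in> pareto_set f g \<Longrightarrow> f p \<le> f x2"
  using pareto_setD[of p g f x2] g.nonneg by (simp add: pareto_set_commute[of f])

lemma image_pareto_set: "f ` pareto_set f g = {0..f x2}"
proof safe
  fix u assume u: "u \<in> {0..f x2}"
  show "u \<in> f ` pareto_set f g"
    by (rule ex_pareto_at_level[OF f.strictly_convex g.strictly_convex g.continuous
          f.compact_sublevel, of x2 x1 u]) (use u g.nonneg in auto)
qed (auto simp: f.nonneg pareto_le)

text \<open>The Pareto point \<open>p\<close> is compared with the point of the segment from
  \<open>x1\<close> to \<open>x2\<close> that has the same value of \<open>f\<close>.\<close>

lemma parabola_bound:
  assumes "p \<in> pareto_set f g"
  shows "f p \<le> f x2 / (g x1)\<^sup>2 * (g p - g x1)\<^sup>2"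
proof -
  \<comment> \<open>By homogeneity about \<open>x1\<close>, this parameter gives the segment point
    the level \<open>s\<^sup>2 * f x2 = f p\<close>.\<close>
  define s where "s = sqrt (f p / f x2)"
  have s: "0 \<le> s" "s \<le> 1" "s\<^sup>2 * f x2 = f p"
    using pos f.nonneg[of p] pareto_le[OF assms] by (auto simp: s_def)
  have "x1 + s *\<^sub>R (x2 - x1) = x2 + (1 - s) *\<^sub>R (x1 - x2)" by (simp add: algebra_simps)
  then have "g (x1 + s *\<^sub>R (x2 - x1)) = (1 - s)\<^sup>2 * g x1" using g.on_ray by simp
  with pareto_setD[OF assms, of "x1 + s *\<^sub>R (x2 - x1)"]
  have "g p \<le> (1 - s)\<^sup>2 * g x1" using s(3) by (simp add: f.on_ray)
  \<comment> \<open>Weakening \<open>(1 - s)\<^sup>2\<close> to \<open>1 - s\<close> makes the bound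
    linear in \<open>s\<close>; squaring it then brings back \<open>s\<^sup>2\<close>, that is,
    \<open>f p / f x2\<close>.\<close>
  also have "\<dots> \<le> (1 - s) * g x1"
    using s pos by (intro mult_right_mono) (auto simp: power2_eq_square mult_left_le)
  finally have "s * g x1 \<le> g x1 - g p" by (simp add: algebra_simps)
  then have "(s * g x1)\<^sup>2 \<le> (g x1 - g p)\<^sup>2" using s pos by (intro power_mono) auto
  then have "s\<^sup>2 * (g x1)\<^sup>2 * f x2 \<le> (g p - g x1)\<^sup>2 * f x2"
    using pos by (intro mult_right_mono) (auto simp: power_mult_distrib power2_commute)
  also have "s\<^sup>2 * (g x1)\<^sup>2 * f x2 = f p * (g x1)\<^sup>2" using s(3) by (simp add: algebra_simps)
  finally show ?thesis using pos by (simp add: field_simps)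
qed

text \<open>Level 0 is attained on the Pareto set, and \<open>x1\<close> is the only zero of
  \<open>f\<close>.\<close>

lemma center_pareto: "x1 \<in> pareto_set f g"
proof -
  obtain p where "p \<in> pareto_set f g" "f p = 0"
    using image_pareto_set pos by (metis atLeastAtMost_iff imageE less_imp_le order_refl)
  then show ?thesis using f.pos[of p] by (cases "p = x1") auto
qed

(* The level of g is prescribed, not that of f: the parabola bound then makes f tend to 0. *)
lemma ex_pareto_near:
  assumes "0 < e"
  obtains p where "p \<in> pareto_set f g" "g p \<noteq> g x1" "\<bar>f p\<bar> < e" "\<bar>g p - g x1\<bar> < e"
proof -
  let ?K = "f x2 / (g x1)\<^sup>2"
  have "((\<lambda>d. ?K * d\<^sup>2) \<longlongrightarrow> ?K * 0\<^sup>2) (at_right 0)" by (intro tendsto_intros)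
  then have "\<forall>\<^sub>F d in at_right 0. ?K * d\<^sup>2 < e"
    using assms by (intro order_tendstoD(2)) auto
  moreover have "\<forall>\<^sub>F d in at_right 0. d \<in> {0<..<min e (g x1)}"
    using assms pos by (intro eventually_at_right_real) auto
  ultimately have "\<forall>\<^sub>F d in at_right (0::real). ?K * d\<^sup>2 < e \<and> 0 < d \<and> d < e \<and> d < g x1"
    by eventually_elim auto
  then obtain d where d: "?K * d\<^sup>2 < e" "0 < d" "d < e" "d < g x1"
    using eventually_happens[of _ "at_right (0::real)"] by auto
  \<comment> \<open>With the roles of \<open>f\<close> and \<open>g\<close> exchanged, the Pareto
    values of \<open>g\<close> fill the interval from 0 to \<open>g x1\<close>.\<close>
  have "g x1 - d \<in> g ` pareto_set g f"
    using d pd_quadratic_pair.image_pareto_set[OF swap] by simp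
  then obtain p where p: "p \<in> pareto_set f g" "g p = g x1 - d"
    by (metis imageE pareto_set_commute)
  show ?thesis using that[OF p(1)] parabola_bound[OF p(1)] p(2) d f.nonneg[of p] by simp
qed

end

theorem corollary3:
  fixes x1 x2 :: "real^'n" and Q1 Q2 :: "real^'n^'n" and \<alpha> \<beta> :: real
    and f1 f2 :: "real^'n \<Rightarrow> real"
  assumes "x1 \<noteq> x2" and "\<alpha> > 0" and "\<beta> > 0"
    and "symmetric_matrix Q1" and "positive_definite Q1"
    and "symmetric_matrix Q2" and "positive_definite Q2"
    and "\<And>x. f1 x = 1 / \<alpha> * ((x - x1) \<bullet> (Q1 *v (x - x1)))"
    and "\<And>x. f2 x = 1 / \<beta> * ((x - x2) \<bullet> (Q2 *v (x - x2)))"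
  shows "convex_curve (pareto_front f1 f2) \<and>
    vertical_tangent (pareto_front f1 f2) (0, f2 x1) \<and>
    horizontal_tangent (pareto_front f1 f2) (f1 x2, 0)"
proof (intro conjI)
  let ?F = "pareto_front f1 f2"
  interpret A: pd_quadratic_pair Q1 x1 "1 / \<alpha>" f1 Q2 x2 "1 / \<beta>" f2
    using assms by unfold_locales auto
  \<comment> \<open>The exchanged pair serves the horizontal tangent; only the symmetry of the
    Pareto set has to be added.\<close>
  interpret B: pd_quadratic_pair Q2 x2 "1 / \<beta>" f2 Q1 x1 "1 / \<alpha>" f1
    by (rule A.swap)
  have F: "q \<in> ?F \<longleftrightarrow> (\<exists>p \<in> pareto_set f1 f2. q = (f1 p, f2 p))" for q
    by (auto simp: pareto_front_def)
  show "convex_curve ?F"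
    using A.image_pareto_set
    by (intro convex_curve_pareto_front A.f.strictly_convex A.g.strictly_convex) simp
  \<comment> \<open>The Euclidean distance is at most the sum of the coordinate differences, hence
    \<open>e / 2\<close> for each coordinate.\<close>
  have near: "dist (u, v) (u', v') < e" if "\<bar>u - u'\<bar> < e / 2" "\<bar>v - v'\<bar> < e / 2"
    for u v u' v' e :: real
    using that sqrt_sum_squares_le_sum_abs[of "u - u'" "v - v'"]
    by (simp add: dist_prod_def dist_real_def)
  show "vertical_tangent ?F (0, f2 x1)"
  proof (rule vertical_tangentI[where K = "f1 x2 / (f2 x1)\<^sup>2"])
    show "(0, f2 x1) \<in> ?F" using A.center_pareto by (auto simp: F intro!: bexI[of _ x1])
    show "(0, f2 x1) islimpt ?F"
      unfolding islimpt_approachable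
    proof (intro allI impI)
      fix e :: real assume "0 < e"
      then obtain p where "p \<in> pareto_set f1 f2" "f2 p \<noteq> f2 x1" "\<bar>f1 p\<bar> < e / 2" "\<bar>f2 p - f2 x1\<bar> < e / 2"
        using A.ex_pareto_near[of "e / 2"] by auto
      then show "\<exists>q\<in>?F. q \<noteq> (0, f2 x1) \<and> dist q (0, f2 x1) < e"
        by (intro bexI[of _ "(f1 p, f2 p)"]) (auto simp: F intro: near)
    qed
  qed (use A.parabola_bound A.f.nonneg in \<open>auto simp: F\<close>)
  show "horizontal_tangent ?F (f1 x2, 0)"
  proof (rule horizontal_tangentI[where K = "f2 x1 / (f1 x2)\<^sup>2"])
    show "(f1 x2, 0) \<in> ?F" using B.center_pareto
      by (auto simp: F pareto_set_commute[of f1] intro!: bexI[of _ x2])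
    show "(f1 x2, 0) islimpt ?F"
      unfolding islimpt_approachable
    proof (intro allI impI)
      fix e :: real assume "0 < e"
      then obtain p where "p \<in> pareto_set f1 f2" "f1 p \<noteq> f1 x2" "\<bar>f2 p\<bar> < e / 2" "\<bar>f1 p - f1 x2\<bar> < e / 2"
        using B.ex_pareto_near[of "e / 2"] by (auto simp: pareto_set_commute[of f1])
      then show "\<exists>q\<in>?F. q \<noteq> (f1 x2, 0) \<and> dist q (f1 x2, 0) < e"
        by (intro bexI[of _ "(f1 p, f2 p)"]) (auto simp: F intro: near)
    qed
  qed (use B.parabola_bound A.g.nonneg in \<open>auto simp: F pareto_set_commute[of f1]\<close>)
qed

end
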